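(* Let $k$ and $\ell$ be positive integers. Then all the non-real zeros of the polynomial $R_{k,\ell}(x)$ lie on the unit circle. More specifically, except for two real zeros of the form $\alpha_{k,\ell}$ and $\dfrac{1}{\alpha_{k,\ell}}$ with $\alpha_{k,\ell}>1$, the remaining zeros of $R_{k,\ell}(x)$ lie on the unit circle $\{z\in\mathbb{C}: |z|=1\}$. Moreover, all the zeros of $R_{k,\ell}(x)$ are simple.
   Context: The Bernoulli numbers $B_n$ are defined by $\frac{t}{e^t-1}=\sum_{n\ge 0}\frac{B_n}{n!}t^n$ for $|t|<2\pi$. For positive integers $k,\ell$, $$R_{k,\ell}(x):=\sum_{j=0}^{k+1}(-1)^{(\ell+1)j}\left(\frac{B_{2j}}{(2j)!}\cdot\frac{B_{2k+2-2j}}{(2k+2-2j)!}\right)^{\ell}x^j .$$ Zeros are taken in $\mathbb{C}$. *)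

theory Defs
  imports "HOL-Complex_Analysis.Complex_Analysis"
begin

definition bernoulli :: "nat \<Rightarrow> real" where
  "bernoulli n = fact n * fps_nth (fps_X / (fps_exp 1 - 1)) n"

text \<open>
  The quotient of formal power series in the definition is the Taylor series of
  \<open>t / (exp t - 1)\<close>, whose removable singularity at \<open>0\<close> is filled with the value \<open>1\<close>;
  it converges on the disc of radius \<open>2 * pi\<close>.
\<close>

lemma bernoulli_sums:
  fixes t :: complex
  assumes "norm t < 2 * pi"
  shows "(\<lambda>n. complex_of_real (bernoulli n) / fact n * t ^ n) sums
           (if t = 0 then 1 else t / (exp t - 1))"
proof -
  have subR: "subdegree (fps_exp 1 - 1 :: real fps) = 1"
    by (rule subdegreeI) auto
  have sub: "subdegree (fps_exp 1 - 1 :: complex fps) = 1"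
    by (rule subdegreeI) auto
  have sub': "subdegree (1 - fps_exp 1 :: complex fps) = 1"
    by (rule subdegreeI) auto
  define B where "B = (fps_X / (fps_exp 1 - 1) :: real fps)"
  define C where "C = Abs_fps (\<lambda>n. complex_of_real (fps_nth B n))"
  let ?E = "fps_exp 1 - 1 :: complex fps"
  have nzR: "fps_exp 1 - 1 \<noteq> (0 :: real fps)" and nz: "?E \<noteq> 0"
    using subR sub by auto
  have "(fps_exp 1 - 1 :: real fps) dvd fps_X"
    using nzR subR by (metis fps_X_neq_zero fps_dvd_iff order_refl subdegree_fps_X)
  hence BR: "B * (fps_exp 1 - 1) = fps_X"
    by (simp add: B_def)
  have "C * ?E = fps_X"
  proof (rule fps_ext)
    fix n
    have "fps_nth (C * ?E) n = complex_of_real (fps_nth (B * (fps_exp 1 - 1)) n)"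
      by (simp add: fps_mult_nth C_def if_distrib cong: if_cong)
    also have "\<dots> = fps_nth fps_X n"
      by (subst BR) simp
    finally show "fps_nth (C * ?E) n = fps_nth fps_X n" .
  qed
  hence C: "C = fps_X / ?E"
    using nz by (metis nonzero_mult_div_cancel_right)
  let ?f = "\<lambda>z::complex. if z = 0 then 1 else z / (exp z - 1)"
  have E0: "exp z - 1 \<noteq> 0" if "norm z < 2 * pi" "z \<noteq> 0" for z :: complex
    using exp_complex_eqI[of z 0] abs_Im_le_cmod[of z] that by auto
  have exp: "?f has_fps_expansion C"
    unfolding C
    by (rule has_fps_expansion_divide)
       (use nz in \<open>auto simp: sub sub' intro!: fps_expansion_intros\<close>)
  have ev: "eval_fps ?E z = exp z - 1" for z
    by (subst eval_fps_diff) auto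
  have rE: "fps_conv_radius ?E = \<infinity>"
    using fps_conv_radius_diff[of "fps_exp 1" "1 :: complex fps"] by simp
  have nz': "eval_fps ?E z \<noteq> 0" if "z \<in> eball 0 (ereal (2 * pi))" "z \<noteq> 0" for z
    using E0[of z] that by (simp add: ev)
  have rad: "fps_conv_radius C \<ge> ereal (2 * pi)"
    unfolding C using fps_conv_radius_divide[of ?E fps_X "ereal (2 * pi)"] nz nz' rE
    by (simp add: sub sub')
  have evC: "eval_fps C t = ?f t"
    unfolding C using eval_fps_divide[of ?E fps_X "ereal (2 * pi)" t 1] nz nz' rE assms
    by (simp add: sub sub' ev)
  have "ereal (norm t) < fps_conv_radius C"
    using assms rad by (meson less_ereal.simps(1) less_le_trans)
  from sums_eval_fps[OF this] show ?thesis
    unfolding evC by (simp add: C_def B_def bernoulli_def)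
qed

definition R_poly :: "nat \<Rightarrow> nat \<Rightarrow> complex poly" where
  "R_poly k l = (\<Sum>j = 0..k + 1. monom (complex_of_real
     ((-1) ^ ((l + 1) * j) *
      (bernoulli (2 * j) / fact (2 * j) *
       (bernoulli (2 * k + 2 - 2 * j) / fact (2 * k + 2 - 2 * j))) ^ l)) j)"

end

theory Submission
  imports Defs
begin

text \<open>
  Put \<open>n = k + 1\<close>. Euler's formula for the even zeta values gives, for \<open>j \<ge> 1\<close>,
  \<open>B\<^bsub>2j\<^esub> / (2j)! = (-1)\<^bsup>j+1\<^esup> 2 \<zeta>(2j) / (2\<pi>)\<^bsup>2j\<^esup>\<close>, whereas the quotient is \<open>1\<close> for \<open>j = 0\<close>. With
  \<open>\<eta> = (-1)\<^sup>l\<close> and the substitution \<open>y = -\<eta> x\<close> all the signs collapse, and up to a constant factor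
  \<open>R\<close> becomes the self-reciprocal real polynomial
  \<open>F y = E (1 + y\<^sup>n) + \<eta> \<Sum>\<^bsub>0<j<n\<^esub> a\<^sub>j y\<^sup>j\<close>, where \<open>E = \<zeta>(2n)\<^sup>l\<close> and
  \<open>a\<^sub>j = (2 \<zeta>(2j) \<zeta>(2n - 2j))\<^sup>l\<close>. Only three features of the numbers \<open>a\<^sub>j\<close> matter: they are
  symmetric under \<open>j \<mapsto> n - j\<close>; they decrease up to the middle index, because \<open>\<zeta>\<close> is
  log-convex; and the smallest of them, \<open>M\<close>, satisfies \<open>M > 2 E\<close>, and even \<open>M \<ge> 4 E\<close> when \<open>l\<close> is even.

  Multiplication by \<open>1 - y\<close> turns the coefficients \<open>a\<^sub>j\<close> into their differences, and the total
  variation of the sequence is only \<open>2 (a\<^sub>1 - M)\<close>. Wherever \<open>\<bar>y\<^sup>j - y\<^bsup>n+1-j\<^esup>\<bar>\<close> is dominated by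
  \<open>\<bar>y - y\<^sup>n\<bar>\<close>, the single term \<open>a\<^sub>1 (y - y\<^sup>n)\<close> therefore outweighs all the differences together, with
  a margin \<open>M \<bar>y - y\<^sup>n\<bar>\<close> that absorbs the terms with \<open>E\<close>. This happens at the \<open>n - 1\<close> points of
  the circle with \<open>y\<^bsup>n-1\<^esup> = -1\<close>. There the real function \<open>y\<^bsup>-n/2\<^esup> F y\<close> alternates in sign
  (lemma \<open>T_alternates\<close>), so it vanishes at \<open>n - 2\<close> distinct points in between.

  Two more zeros are real and reciprocal to each other. The sign of \<open>F (-\<eta> s)\<close> for large \<open>s\<close> is
  given by the leading term, and the opposite sign occurs at some \<open>s \<ge> 1\<close>: for odd \<open>l\<close> at \<open>s = 1\<close>,
  for even \<open>l\<close> at \<open>s = 2\<close>, where the estimate of the previous paragraph applies once more.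
  These are \<open>n\<close> distinct zeros of a polynomial of degree at most \<open>n\<close>, so there are no others and all are simple.
\<close>

section \<open>Log-convexity of the zeta values at even integers\<close>

definition even_zeta :: "nat \<Rightarrow> real" where
  "even_zeta j = (\<Sum>n. 1 / real (Suc n) ^ (2 * j))"

lemma even_zeta_sums:
  assumes "j \<ge> 1"
  shows "(\<lambda>n. 1 / real (Suc n) ^ (2 * j)) sums even_zeta j"
proof -
  have "summable (\<lambda>n. inverse (real n ^ (2 * j)))"
    using assms by (intro inverse_power_summable) auto
  hence "summable (\<lambda>n. 1 / real (Suc n) ^ (2 * j))"
    by (subst (asm) summable_Suc_iff[symmetric]) (simp add: inverse_eq_divide)
  thus ?thesis
    unfolding even_zeta_def by (rule summable_sums)
qed

lemma even_zeta_gt_1: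
  assumes "j \<ge> 1"
  shows "even_zeta j > 1"
proof -
  have "(\<Sum>n<1. 1 / real (Suc n) ^ (2 * j)) < even_zeta j"
    unfolding even_zeta_def using even_zeta_sums[OF assms]
    by (intro sum_less_suminf) (auto simp: sums_iff)
  thus ?thesis by simp
qed

lemma even_zeta_antimono:
  assumes "1 \<le> i" "i \<le> j"
  shows "even_zeta j \<le> even_zeta i"
proof (rule sums_le[OF _ even_zeta_sums even_zeta_sums])
  show "1 / real (Suc n) ^ (2 * j) \<le> 1 / real (Suc n) ^ (2 * i)" for n
    using assms by (intro divide_left_mono power_increasing) auto
qed (use assms in auto)

text \<open>
  This is the Cauchy-Schwarz inequality for the two square-summable sequences \<open>m\<^bsup>-j\<^esup>\<close> and \<open>m\<^bsup>-j-2\<^esup>\<close>: it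
  expresses that the quadratic polynomial \<open>t \<mapsto> \<Sum>\<^sub>m m\<^bsup>-2j\<^esup> (1 - t / m\<^sup>2)\<^sup>2\<close> is nonnegative at its minimum.
\<close>

lemma even_zeta_log_convex:
  assumes "j \<ge> 1"
  shows "even_zeta (Suc j) ^ 2 \<le> even_zeta j * even_zeta (Suc (Suc j))"
proof -
  define x y z where "x = even_zeta j" and "y = even_zeta (Suc j)" and "z = even_zeta (Suc (Suc j))"
  have z: "z > 0" unfolding z_def using even_zeta_gt_1[of "Suc (Suc j)"] by simp
  define t where "t = y / z"
  have "(\<lambda>n. 1 / real (Suc n) ^ (2 * j) - 2 * t * (1 / real (Suc n) ^ (2 * Suc j)) +
           t ^ 2 * (1 / real (Suc n) ^ (2 * Suc (Suc j)))) sums (x - 2 * t * y + t ^ 2 * z)"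
    unfolding x_def y_def z_def using assms
    by (intro sums_add sums_diff sums_mult even_zeta_sums) auto
  moreover have "1 / real (Suc n) ^ (2 * j) - 2 * t * (1 / real (Suc n) ^ (2 * Suc j)) +
           t ^ 2 * (1 / real (Suc n) ^ (2 * Suc (Suc j))) \<ge> 0" for n
  proof -
    define v where "v = real (Suc n)"
    have v: "v > 0" by (simp add: v_def)
    have "1 / v ^ (2 * j) - 2 * t * (1 / v ^ (2 * Suc j)) + t ^ 2 * (1 / v ^ (2 * Suc (Suc j))) =
            (1 / v ^ j) ^ 2 * (1 - t / v ^ 2) ^ 2"
    proof -
      have "v ^ (2 * j) = v ^ j * v ^ j"
        by (simp add: power_add mult_2)
      thus ?thesis using v by (simp add: field_simps power2_eq_square)
    qed
    thus ?thesis unfolding v_def by simp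
  qed
  ultimately have "0 \<le> x - 2 * t * y + t ^ 2 * z"
    by (rule sums_le[OF _ sums_zero, rotated])
  also have "\<dots> = x - y ^ 2 / z"
    using z by (simp add: t_def field_simps power2_eq_square)
  finally show ?thesis
    using z by (simp add: x_def y_def z_def field_simps)
qed

lemma even_zeta_ratio_mono:
  assumes "1 \<le> i" "i \<le> j"
  shows "even_zeta (Suc i) / even_zeta i \<le> even_zeta (Suc j) / even_zeta j"
  using assms(2)
proof (induction j rule: dec_induct)
  case (step j)
  have pos: "even_zeta j > 0" "even_zeta (Suc j) > 0"
    using even_zeta_gt_1[of j] even_zeta_gt_1[of "Suc j"] step.hyps assms(1) by auto
  note step.IH
  also have "even_zeta (Suc j) / even_zeta j \<le> even_zeta (Suc (Suc j)) / even_zeta (Suc j)"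
    using even_zeta_log_convex[of j] pos step.hyps assms(1)
    by (simp add: field_simps power2_eq_square)
  finally show ?case .
qed simp

text \<open>
  Log-convexity says that the ratio of consecutive values increases. As \<open>j \<le> n - j - 1\<close>, the ratio
  at \<open>j\<close> is at most the one at \<open>n - j - 1\<close>, and clearing denominators gives the claim.
\<close>

lemma even_zeta_product_decreasing:
  assumes "1 \<le> j" "2 * Suc j \<le> n"
  shows "even_zeta (Suc j) * even_zeta (n - Suc j) \<le> even_zeta j * even_zeta (n - j)"
proof -
  have "n - Suc j \<ge> 1"
    using assms by simp
  hence pos: "even_zeta j > 0" "even_zeta (n - Suc j) > 0"
    using even_zeta_gt_1[of j] even_zeta_gt_1[of "n - Suc j"] assms by auto
  have "Suc (n - Suc j) = n - j"
    using assms by auto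
  thus ?thesis
    using even_zeta_ratio_mono[of j "n - Suc j"] pos assms by (simp add: field_simps)
qed

section \<open>Bernoulli numbers as even zeta values\<close>

text \<open>
  The logarithmic derivative of the reflection formula
  \<open>\<Gamma>(1 + u) \<Gamma>(1 - u) sin (\<pi> u) = \<pi> u\<close>. It is a form of the partial fraction expansion of the
  cotangent whose left-hand side has an explicit Taylor series at \<open>0\<close>.
\<close>

lemma Digamma_cot:
  fixes w :: complex
  assumes "w \<noteq> 0" and "norm w < 1"
  shows "Digamma (1 - w) - Digamma (1 + w) = of_real pi * cot (of_real pi * w) - 1 / w"
proof -
  have pos: "Re w < 1" "Re w > -1"
    using abs_Re_le_cmod[of w] assms(2) by auto
  have ni: "1 - w \<notin> \<int>\<^sub>\<le>\<^sub>0" "1 + w \<notin> \<int>\<^sub>\<le>\<^sub>0"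
    using pos by (auto elim!: nonpos_Ints_cases simp: complex_eq_iff)
  have nz: "sin (of_real pi * w) \<noteq> 0"
  proof
    assume "sin (of_real pi * w) = 0"
    then obtain k :: int where "of_real pi * w = of_real (of_int k * pi)"
      unfolding sin_eq_0 by (auto simp: mult.commute)
    hence "w = of_int k" by (simp add: field_simps)
    moreover from this have "\<bar>k\<bar> < 1" using assms(2) by simp
    ultimately show False using assms(1) by simp
  qed
  define f where "f = (\<lambda>u::complex. rGamma (1 + u) * rGamma (1 - u) * of_real pi * u)"
  have f: "f u = sin (of_real pi * u)" for u
  proof -
    have "f u = (u * rGamma (u + 1)) * rGamma (1 - u) * of_real pi"
      by (simp add: f_def mult_ac add.commute)
    also have "\<dots> = sin (of_real pi * u)"
      unfolding rGamma_plus1 using rGamma_reflection_complex[of u] by simp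
    finally show ?thesis .
  qed
  have "(f has_field_derivative
          f w * (Digamma (1 - w) - Digamma (1 + w)) + rGamma (1 + w) * rGamma (1 - w) * of_real pi) (at w)"
    unfolding f_def using ni by (auto intro!: derivative_eq_intros simp: algebra_simps)
  moreover have "(f has_field_derivative of_real pi * cos (of_real pi * w)) (at w)"
    unfolding f[abs_def] by (auto intro!: derivative_eq_intros simp: algebra_simps)
  ultimately have "f w * (Digamma (1 - w) - Digamma (1 + w)) + rGamma (1 + w) * rGamma (1 - w) * of_real pi
                    = of_real pi * cos (of_real pi * w)"
    by (rule DERIV_unique)
  moreover have "rGamma (1 + w) * rGamma (1 - w) * of_real pi = f w / w"
    using assms(1) by (simp add: f_def)
  ultimately have "sin (of_real pi * w) * (Digamma (1 - w) - Digamma (1 + w) + 1 / w)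
                    = of_real pi * cos (of_real pi * w)"
    unfolding f by (simp add: distrib_left)
  hence "Digamma (1 - w) - Digamma (1 + w) + 1 / w = of_real pi * cot (of_real pi * w)"
    using nz by (simp add: cot_def eq_divide_eq mult.commute)
  thus ?thesis by (simp add: algebra_simps)
qed

lemma Digamma_power_series:
  fixes w :: complex
  assumes "norm w < 1"
  shows "(\<lambda>n. Polygamma n 1 / fact n * w ^ n) sums Digamma (1 + w)"
proof -
  have "z \<notin> \<int>\<^sub>\<le>\<^sub>0" if "z \<in> ball 1 1" for z :: complex
    using that abs_Re_le_cmod[of "1 - z"] by (auto elim!: nonpos_Ints_cases simp: dist_norm)
  hence "ball (1::complex) 1 \<inter> \<int>\<^sub>\<le>\<^sub>0 = {}"
    by blast
  hence "Digamma holomorphic_on ball (1::complex) 1"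
    by (rule holomorphic_on_Polygamma)
  from holomorphic_power_series[OF this, of "1 + w"] assms show ?thesis
    by (simp add: higher_deriv_Polygamma dist_norm)
qed

text \<open>
  Since \<open>\<pi> w cot (\<pi> w) = \<i> \<pi> w + t w / (exp (t w) - 1)\<close> for \<open>t = 2 \<pi> \<i>\<close>, the generating function of
  the Bernoulli numbers expands the same function as the two Digamma series. The Taylor
  coefficients of Digamma at \<open>1\<close> are Polygamma values, which are zeta values up to sign.
\<close>

lemma bernoulli_eq_even_zeta:
  assumes "j \<ge> 1"
  shows "bernoulli (2 * j) / fact (2 * j) = (-1) ^ (j + 1) * 2 * even_zeta j / (2 * pi) ^ (2 * j)"
proof -
  define t :: complex where "t = 2 * pi * \<i>"
  define F where "F = Abs_fps (\<lambda>n. Polygamma n 1 / fact n :: complex)"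
  define G where "G = Abs_fps (\<lambda>n. (-1) ^ n * (Polygamma n 1 / fact n) :: complex)"
  define H where "H = Abs_fps (\<lambda>n. complex_of_real (bernoulli n) / fact n * t ^ n)"
  define g where "g = (\<lambda>u::complex. if u = 0 then 1 else u / (exp u - 1))"
  have ev: "eventually (\<lambda>w::complex. w \<in> ball 0 1) (nhds 0)"
    by (intro eventually_nhds_in_open) auto
  have F: "(\<lambda>w. Digamma (1 + w)) has_fps_expansion F"
    by (rule has_fps_expansionI, rule eventually_mono[OF ev])
       (use Digamma_power_series in \<open>auto simp: F_def\<close>)
  have G: "(\<lambda>w. Digamma (1 - w)) has_fps_expansion G"
  proof (rule has_fps_expansionI, rule eventually_mono[OF ev])
    fix w :: complex assume "w \<in> ball 0 1"
    with Digamma_power_series[of "-w"] show "(\<lambda>n. fps_nth G n * w ^ n) sums Digamma (1 - w)"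
      by (simp add: G_def power_minus[of w] mult_ac)
  qed
  have H: "(\<lambda>w. g (t * w)) has_fps_expansion H"
  proof (rule has_fps_expansionI, rule eventually_mono[OF ev])
    fix w :: complex assume "w \<in> ball 0 1"
    hence "norm (t * w) < 2 * pi"
      by (simp add: t_def norm_mult)
    from bernoulli_sums[OF this] show "(\<lambda>n. fps_nth H n * w ^ n) sums g (t * w)"
      by (simp add: H_def g_def power_mult_distrib mult_ac)
  qed
  have "(\<lambda>w. w * (Digamma (1 - w) - Digamma (1 + w)) + 1) has_fps_expansion fps_X * (G - F) + 1"
    by (intro fps_expansion_intros F G)
  moreover have "(\<lambda>w. w * (Digamma (1 - w) - Digamma (1 + w)) + 1) has_fps_expansion
                   fps_const (\<i> * of_real pi) * fps_X + H"
  proof -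
    have "eventually (\<lambda>w. \<i> * of_real pi * w + g (t * w) =
            w * (Digamma (1 - w) - Digamma (1 + w)) + 1) (nhds 0)"
    proof (rule eventually_mono[OF ev])
      fix w :: complex assume w: "w \<in> ball 0 1"
      show "\<i> * of_real pi * w + g (t * w) = w * (Digamma (1 - w) - Digamma (1 + w)) + 1"
      proof (cases "w = 0")
        case False
        define q where "q = exp (\<i> * (of_real pi * w))"
        have q: "q \<noteq> 0" "exp (- (\<i> * (of_real pi * w))) = inverse q" "exp (t * w) = q ^ 2"
          by (simp_all add: q_def exp_minus exp_double[symmetric] t_def mult_ac)
        have "exp (t * w) \<noteq> 1"
        proof
          assume "exp (t * w) = 1"
          then obtain k :: int where k: "Re (t*w) = 0" "Im (t * w) = of_int (2 * k) * pi"
            unfolding exp_eq_1 by auto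
          have "w = of_int k" using k by (simp add: t_def complex_eq_iff)
          moreover from this have "\<bar>k\<bar> < 1" using w by simp
          ultimately show False using False by simp
        qed
        hence q1: "q ^ 2 - 1 \<noteq> 0" by (simp add: q)
        have "cot (of_real pi * w) = \<i> * (q ^ 2 + 1) / (q ^ 2 - 1)"
          using q q1 unfolding cot_def sin_exp_eq cos_exp_eq q_def[symmetric] q(2)
          by (simp add: field_simps power2_eq_square)
        hence "w * (Digamma (1 - w) - Digamma (1 + w)) + 1 =
                 w * (of_real pi * (\<i> * (q ^ 2 + 1) / (q ^ 2 - 1)))"
          using Digamma_cot[of w] w False by (simp add: field_simps)
        also have "\<dots> = \<i> * of_real pi * w + g (t * w)"
        proof -
          have "g (t * w) = t * w / (q ^ 2 - 1)"
            using False q(3) by (simp add: g_def t_def)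
          thus ?thesis using q1 by (simp add: t_def field_simps)
        qed
        finally show ?thesis by simp
      qed (simp add: g_def)
    qed
    moreover have "(\<lambda>w. \<i> * of_real pi * w + g (t * w)) has_fps_expansion
                     fps_const (\<i> * of_real pi) * fps_X + H"
      by (intro fps_expansion_intros H)
    ultimately show ?thesis by (subst has_fps_expansion_cong[OF _ refl, symmetric]) 
  qed
  ultimately have eq: "fps_X * (G - F) + 1 = fps_const (\<i> * of_real pi) * fps_X + H"
    by (rule fps_expansion_unique_complex)
  obtain i where i: "j = Suc i" using assms by (cases j) auto
  have P: "(\<lambda>k. inverse ((1 + of_nat k :: complex) ^ (2 * j))) sums
             (Polygamma (2 * i + 1) 1 / fact (2 * i + 1))"
    using Polygamma_LIMSEQ[of "1::complex" "2 * i + 1"] i by simp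
  have "(\<lambda>n. complex_of_real (1 / real (Suc n) ^ (2 * j))) sums complex_of_real (even_zeta j)"
    by (intro sums_of_real even_zeta_sums assms)
  hence "(\<lambda>k. inverse ((1 + of_nat k :: complex) ^ (2 * j))) sums of_real (even_zeta j)"
    by (simp add: inverse_eq_divide)
  with P have P': "Polygamma (2 * i + 1) 1 / fact (2 * i + 1) = complex_of_real (even_zeta j)"
    by (rule sums_unique2)
  have "fps_nth (fps_X * (G - F) + 1) (2 * j) = - 2 * complex_of_real (even_zeta j)"
    using P' i by (simp add: F_def G_def)
  moreover have "fps_nth (fps_const (\<i> * of_real pi) * fps_X + H) (2 * j) =
                   complex_of_real (bernoulli (2 * j) / fact (2 * j) * (-1) ^ j * (2 * pi) ^ (2 * j))"
    using i by (simp add: H_def t_def power_mult_distrib power_mult[of \<i>])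
  ultimately have "complex_of_real (bernoulli (2 * j) / fact (2 * j) * (-1) ^ j * (2 * pi) ^ (2 * j)) =
                     complex_of_real (- 2 * even_zeta j)"
    using eq by simp
  hence "bernoulli (2 * j) / fact (2 * j) * (-1) ^ j * (2 * pi) ^ (2 * j) = - 2 * even_zeta j"
    by (simp only: of_real_eq_iff)
  hence "bernoulli (2 * j) / fact (2 * j) * (-1) ^ j = - 2 * even_zeta j / (2 * pi) ^ (2 * j)"
    by (subst eq_divide_eq) simp
  hence "bernoulli (2 * j) / fact (2 * j) * ((-1) ^ j * (-1) ^ j) =
           - 2 * even_zeta j / (2 * pi) ^ (2 * j) * (-1) ^ j"
    by (simp only: mult.assoc[symmetric])
  thus ?thesis by (simp flip: power_add)
qed

section \<open>Self-reciprocal polynomials with valley-shaped coefficients\<close>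

lemma cis_diff: "cis x - cis y = 2 * \<i> * of_real (sin ((x - y) / 2)) * cis ((x + y) / 2)"
proof -
  have "cis ((x + y) / 2 + (x - y) / 2) - cis ((x + y) / 2 - (x - y) / 2) =
          2 * \<i> * of_real (sin ((x - y) / 2)) * cis ((x + y) / 2)"
    by (simp add: complex_eq_iff sin_add cos_add sin_diff cos_diff)
  moreover have "(x + y) / 2 + (x - y) / 2 = x" "(x + y) / 2 - (x - y) / 2 = y"
    by (simp_all add: field_simps)
  ultimately show ?thesis by simp
qed

text \<open>
  The coefficient sequence: \<open>E\<close> at both ends and \<open>\<eta> a\<^sub>j\<close> in between, where \<open>\<bar>\<eta>\<bar> = 1\<close> and \<open>a\<close> is
  symmetric, descends to the middle of its range, and stays above \<open>2 E\<close> there.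
\<close>

locale valley_polynomial =
  fixes n :: nat and E \<eta> :: real and a :: "nat \<Rightarrow> real"
  assumes n_ge_2: "n \<ge> 2"
    and E_pos: "E > 0"
    and sign: "\<eta> = 1 \<or> \<eta> = -1"
    and sym: "\<And>j. 1 \<le> j \<Longrightarrow> j < n \<Longrightarrow> a (n - j) = a j"
    and decreasing: "\<And>j. 1 \<le> j \<Longrightarrow> 2 * Suc j \<le> n \<Longrightarrow> a (Suc j) \<le> a j"
    and middle: "2 * E < a (n div 2)"
begin

definition coef :: "nat \<Rightarrow> real" where
  "coef j = (if j = 0 \<or> j = n then E else \<eta> * a j)"

definition F :: "'a :: real_normed_field \<Rightarrow> 'a" where
  "F y = (\<Sum>j\<le>n. of_real (coef j) * y ^ j)"

lemma F_of_real: "F (of_real x) = of_real (F x)"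
  by (simp add: F_def)

lemma coef_sym: "j \<le> n \<Longrightarrow> coef (n - j) = coef j"
  using sym[of j] by (auto simp: coef_def)

lemma F_inverse:
  assumes "y \<noteq> 0"
  shows "y ^ n * F (inverse y) = F y"
proof -
  have "y ^ n * F (inverse y) = (\<Sum>j\<le>n. of_real (coef j) * y ^ (n - j))"
    unfolding F_def sum_distrib_left
    using assms by (intro sum.cong) (auto simp: power_diff field_simps)
  also have "\<dots> = F y"
    unfolding F_def
    by (rule sum.reindex_bij_witness[of _ "\<lambda>j. n - j" "\<lambda>j. n - j"]) (auto simp: coef_sym)
  finally show ?thesis .
qed

lemma increasing:
  assumes "n \<le> 2 * j" "Suc j < n"
  shows "a j \<le> a (Suc j)"
proof -
  have "a (Suc (n - Suc j)) \<le> a (n - Suc j)"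
    using assms by (intro decreasing) auto
  moreover have "Suc (n - Suc j) = n - j"
    using assms by simp
  ultimately show ?thesis
    using assms n_ge_2 by (simp add: sym)
qed

lemma ge_middle:
  assumes "1 \<le> j" "j < n"
  shows "a (n div 2) \<le> a j"
proof -
  have left: "a (n div 2) \<le> a i" if "1 \<le> i" "i \<le> n div 2" for i
    using that(2,1)
  proof (induction i rule: inc_induct)
    case (step i)
    thus ?case using decreasing[of i] by (force intro: order_trans)
  qed simp
  show ?thesis
  proof (cases "j \<le> n div 2")
    case False
    hence "a (n div 2) \<le> a (n - j)"
      using assms by (intro left) auto
    thus ?thesis using assms by (simp add: sym)
  qed (use left assms in auto)
qed

text \<open>
  The sequence goes down from \<open>a\<^sub>1\<close> to the middle and back up to \<open>a\<^bsub>n-1\<^esub> = a\<^sub>1\<close>, so both sums of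
  absolute differences telescope.
\<close>

lemma total_variation:
  "(\<Sum>j=2..<n. \<bar>a j - a (j - 1)\<bar>) = 2 * (a 1 - a (n div 2))"
proof -
  define h where "h = n div 2"
  have h: "1 \<le> h" "h \<le> n - 1" "2 * h \<le> n" "n \<le> Suc (2 * h)"
    using n_ge_2 by (auto simp: h_def)
  have "{2..<n} = {Suc 1..h} \<union> {Suc h..n - 1}"
    using h by auto
  hence "(\<Sum>j=2..<n. \<bar>a j - a (j - 1)\<bar>) =
           (\<Sum>j\<in>{Suc 1..h}. \<bar>a j - a (j - 1)\<bar>) + (\<Sum>j\<in>{Suc h..n - 1}. \<bar>a j - a (j - 1)\<bar>)"
    by (simp add: sum.union_disjoint)
  also have "(\<Sum>j\<in>{Suc 1..h}. \<bar>a j - a (j - 1)\<bar>) = (\<Sum>j\<in>{Suc 1..h}. - (a j - a (j - 1)))"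
  proof (rule sum.cong)
    fix j assume "j \<in> {Suc 1..h}"
    thus "\<bar>a j - a (j - 1)\<bar> = - (a j - a (j - 1))"
      using decreasing[of "j - 1"] h by auto
  qed simp
  also have "\<dots> = a 1 - a h"
    using sum_telescope''[OF h(1), of a] by (simp only: sum_negf)
  also have "(\<Sum>j\<in>{Suc h..n - 1}. \<bar>a j - a (j - 1)\<bar>) = (\<Sum>j\<in>{Suc h..n - 1}. a j - a (j - 1))"
  proof (rule sum.cong)
    fix j assume j: "j \<in> {Suc h..n - 1}"
    show "\<bar>a j - a (j - 1)\<bar> = a j - a (j - 1)"
    proof (cases "n \<le> 2 * (j - 1)")
      case True
      thus ?thesis using increasing[of "j - 1"] j by auto
    next
      case False
      hence "j = Suc h" "n - h = Suc h" using j h by auto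
      thus ?thesis using sym[of h] h j by auto
    qed
  qed simp
  also have "\<dots> = a (n - 1) - a h"
    using sum_telescope''[OF h(2), of a] by simp
  also have "a (n - 1) = a 1"
    using n_ge_2 by (intro sym) auto
  finally show ?thesis by (simp add: h_def)
qed

lemma F_split:
  "F y = of_real E * (1 + y ^ n) + of_real \<eta> * (\<Sum>j=1..<n. of_real (a j) * y ^ j)"
proof -
  have "{..n} = insert 0 (insert n {1..<n})"
    using n_ge_2 by auto
  hence "F y = of_real (coef 0) + of_real (coef n) * y ^ n + (\<Sum>j=1..<n. of_real (coef j) * y ^ j)"
    using n_ge_2 unfolding F_def by simp
  also have "(\<Sum>j=1..<n. of_real (coef j) * y ^ j) = of_real \<eta> * (\<Sum>j=1..<n. of_real (a j) * y ^ j)"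
    unfolding sum_distrib_left by (intro sum.cong) (auto simp: coef_def)
  finally show ?thesis by (simp add: coef_def algebra_simps)
qed

text \<open>
  The factor 2 avoids halves: the differences of \<open>a\<close> are antisymmetric under \<open>j \<mapsto> n + 1 - j\<close>, so twice
  the sum of \<open>(a\<^sub>j - a\<^bsub>j-1\<^esub>) y\<^sup>j\<close> pairs the powers \<open>y\<^sup>j\<close> and \<open>y\<^bsup>n+1-j\<^esup>\<close>. The paired powers are what
  can be compared with \<open>y - y\<^sup>n\<close>, both on the unit circle and at \<open>y = -2\<close>.
\<close>

lemma summation_by_parts:
  "2 * ((1 - y) * F y) =
     2 * of_real E * (1 - y ^ (n + 1)) + 2 * (of_real (\<eta> * a 1) - of_real E) * (y - y ^ n) +
     of_real \<eta> * (\<Sum>j=2..<n. of_real (a j - a (j - 1)) * (y ^ j - y ^ (n + 1 - j)))"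
proof -
  define d where "d j = (of_real (a j - a (j - 1)) :: 'a)" for j
  define A B where "A = (\<Sum>j=2..<n. of_real (a j) * y ^ j)"
    and "B = (\<Sum>j=2..<n. of_real (a (j - 1)) * y ^ j)"
  have last: "a (n - 1) = a 1"
    using n_ge_2 by (intro sym) auto
  have "(\<Sum>j=1..<n. of_real (a j) * y ^ Suc j) = (\<Sum>j=2..<Suc n. of_real (a (j - 1)) * y ^ j)"
    by (rule sum.reindex_bij_witness[of _ "\<lambda>j. j - 1" Suc]) auto
  hence shifted: "(\<Sum>j=1..<n. of_real (a j) * y ^ Suc j) = B + of_real (a 1) * y ^ n"
    using n_ge_2 last by (simp add: B_def)
  have unshifted: "(\<Sum>j=1..<n. of_real (a j) * y ^ j) = of_real (a 1) * y + A"
    unfolding A_def using n_ge_2 by (subst sum.atLeast_Suc_lessThan) (auto simp: numeral_2_eq_2)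
  have "(1 - y) * (\<Sum>j=1..<n. of_real (a j) * y ^ j) =
          (\<Sum>j=1..<n. of_real (a j) * y ^ j) - (\<Sum>j=1..<n. of_real (a j) * y ^ Suc j)"
    unfolding left_diff_distrib by (simp add: sum_distrib_left mult_ac)
  also have "\<dots> = of_real (a 1) * (y - y ^ n) + (A - B)"
    unfolding shifted unshifted by (simp add: algebra_simps)
  also have "A - B = (\<Sum>j=2..<n. d j * y ^ j)"
    by (simp add: A_def B_def d_def sum_subtractf left_diff_distrib)
  finally have main: "(1 - y) * (\<Sum>j=1..<n. of_real (a j) * y ^ j) =
                        of_real (a 1) * (y - y ^ n) + (\<Sum>j=2..<n. d j * y ^ j)" .
  have "(\<Sum>j=2..<n. d j * y ^ j) = (\<Sum>j=2..<n. - d j * y ^ (n + 1 - j))"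
  proof (rule sum.reindex_bij_witness[of _ "\<lambda>j. n + 1 - j" "\<lambda>j. n + 1 - j"])
    fix j assume j: "j \<in> {2..<n}"
    hence "a (n - (j - 1)) = a (j - 1)" "a (n - j) = a j"
      using sym[of "j - 1"] sym[of j] by auto
    moreover have "n + 1 - j - 1 = n - j" "n - (j - 1) = n + 1 - j" using j by auto
    ultimately show "- d (n + 1 - j) * y ^ (n + 1 - (n + 1 - j)) = d j * y ^ j"
      using j by (simp add: d_def)
  qed auto
  hence "2 * (\<Sum>j=2..<n. d j * y ^ j) = (\<Sum>j=2..<n. d j * (y ^ j - y ^ (n + 1 - j)))"
    by (simp add: sum_subtractf sum_negf right_diff_distrib)
  hence half: "(\<Sum>j=2..<n. d j * (y ^ j - y ^ (n + 1 - j))) = 2 * (\<Sum>j=2..<n. d j * y ^ j)"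
    by simp
  have eq: "(1 - y) * F y = of_real E * ((1 - y) * (1 + y ^ n)) +
          of_real \<eta> * ((1 - y) * (\<Sum>j=1..<n. of_real (a j) * y ^ j))"
    unfolding F_split by (simp add: algebra_simps)
  show ?thesis
    unfolding eq main d_def[symmetric] half by (simp add: algebra_simps)
qed

text \<open>
  By self-reciprocity, \<open>F\<close> on the unit circle is a phase times the following real function, so that
  zeros on the circle can be detected by sign changes.
\<close>

definition T :: "real \<Rightarrow> real" where
  "T \<phi> = (\<Sum>j\<le>n. coef j * cos ((real j - real n / 2) * \<phi>))"

lemma F_cis: "F (cis \<phi>) = cis (real n * \<phi> / 2) * of_real (T \<phi>)"
proof -
  define S where "S = (\<Sum>j\<le>n. coef j * sin ((real j - real n / 2) * \<phi>))"
  have "S = (\<Sum>j\<le>n. - (coef j * sin ((real j - real n / 2) * \<phi>)))"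
    unfolding S_def
  proof (rule sum.reindex_bij_witness[of _ "\<lambda>j. n - j" "\<lambda>j. n - j"])
    fix j assume j: "j \<in> {..n}"
    hence "(real (n - j) - real n / 2) * \<phi> = - ((real j - real n / 2) * \<phi>)"
      by (simp add: of_nat_diff algebra_simps)
    thus "- (coef (n - j) * sin ((real (n - j) - real n / 2) * \<phi>)) =
            coef j * sin ((real j - real n / 2) * \<phi>)"
      using j by (simp only: coef_sym atMost_iff sin_minus)
  qed auto
  hence "S = 0"
    by (simp add: sum_negf flip: S_def)
  have "F (cis \<phi>) = (\<Sum>j\<le>n. cis (real n * \<phi> / 2) *
                        (of_real (coef j) * cis ((real j - real n / 2) * \<phi>)))"
    unfolding F_def
  proof (rule sum.cong)
    fix j
    have "cis (real n * \<phi> / 2) * cis ((real j - real n / 2) * \<phi>) = cis \<phi> ^ j"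
      by (simp add: cis_mult Complex.DeMoivre algebra_simps)
    thus "complex_of_real (coef j) * cis \<phi> ^ j =
            cis (real n * \<phi> / 2) * (of_real (coef j) * cis ((real j - real n / 2) * \<phi>))"
      by (simp add: mult_ac)
  qed simp
  also have "\<dots> = cis (real n * \<phi> / 2) *
                    (\<Sum>j\<le>n. of_real (coef j) * cis ((real j - real n / 2) * \<phi>))"
    by (simp add: sum_distrib_left)
  also have "(\<Sum>j\<le>n. of_real (coef j) * cis ((real j - real n / 2) * \<phi>)) = Complex (T \<phi>) S"
    by (simp add: complex_eq_iff T_def S_def)
  also have "\<dots> = of_real (T \<phi>)"
    using \<open>S = 0\<close> by (simp add: complex_eq_iff)
  finally show ?thesis .
qed

text \<open>
  The general summation by parts at \<open>y = cis \<phi>\<close>: every difference of powers in it is a real sine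
  times the same factor \<open>- 2 \<i> cis ((n + 1) \<phi> / 2)\<close>.
\<close>

lemma T_by_parts:
  "2 * (sin (\<phi> / 2) * T \<phi>) =
     2 * E * sin (real (n + 1) * \<phi> / 2) + 2 * (\<eta> * a 1 - E) * sin (real (n - 1) * \<phi> / 2) +
     \<eta> * (\<Sum>j=2..<n. (a j - a (j - 1)) * sin ((real (n + 1) / 2 - real j) * \<phi>))"
    (is "_ = ?R")
proof -
  define u where "u = - 2 * \<i> * cis (real (n + 1) * \<phi> / 2)"
  have u: "u \<noteq> 0" by (simp add: u_def)
  have diff: "cis \<phi> ^ j - cis \<phi> ^ (n + 1 - j) = u * of_real (sin ((real (n + 1) / 2 - real j) * \<phi>))"
    if "j \<le> n" for j
  proof -
    have "cis \<phi> ^ j - cis \<phi> ^ (n + 1 - j) = cis (real j * \<phi>) - cis (real (n + 1 - j) * \<phi>)"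
      by (simp add: Complex.DeMoivre)
    also have "\<dots> = 2 * \<i> * of_real (sin (- ((real (n + 1) / 2 - real j) * \<phi>))) * cis (real (n + 1) * \<phi> / 2)"
    proof -
      have "(real j * \<phi> - real (n + 1 - j) * \<phi>) / 2 = - ((real (n + 1) / 2 - real j) * \<phi>)"
        "(real j * \<phi> + real (n + 1 - j) * \<phi>) / 2 = real (n + 1) * \<phi> / 2"
        using that by (simp_all add: of_nat_diff field_simps)
      thus ?thesis by (simp only: cis_diff)
    qed
    also have "\<dots> = u * of_real (sin ((real (n + 1) / 2 - real j) * \<phi>))"
      by (simp add: u_def)
    finally show ?thesis .
  qed
  have half: "(real (n + 1) / 2 - real 1) * \<phi> = real (n - 1) * \<phi> / 2"
    using n_ge_2 by (simp add: of_nat_diff field_simps)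
  have "u * of_real (2 * (sin (\<phi> / 2) * T \<phi>)) = 2 * ((1 - cis \<phi>) * F (cis \<phi>))"
  proof -
    have "1 - cis \<phi> = - 2 * \<i> * of_real (sin (\<phi> / 2)) * cis (\<phi> / 2)"
      using cis_diff[of 0 \<phi>] by simp
    moreover have "cis (\<phi> / 2) * cis (real n * \<phi> / 2) = cis (real (n + 1) * \<phi> / 2)"
      by (simp add: cis_mult field_simps)
    ultimately show ?thesis
      unfolding F_cis u_def by (simp add: mult_ac)
  qed
  also have "\<dots> = u * of_real ?R"
  proof -
    have "(\<Sum>j=2..<n. of_real (a j - a (j - 1)) * (cis \<phi> ^ j - cis \<phi> ^ (n + 1 - j))) =
            (\<Sum>j=2..<n. u * (of_real ((a j - a (j - 1)) * sin ((real (n + 1) / 2 - real j) * \<phi>))))"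
      by (intro sum.cong refl, subst diff) (auto simp: mult_ac)
    also have "\<dots> = u * of_real (\<Sum>j=2..<n. (a j - a (j - 1)) * sin ((real (n + 1) / 2 - real j) * \<phi>))"
      by (simp add: sum_distrib_left)
    finally have inner: "(\<Sum>j=2..<n. of_real (a j - a (j - 1)) * (cis \<phi> ^ j - cis \<phi> ^ (n + 1 - j))) =
      u * of_real (\<Sum>j=2..<n. (a j - a (j - 1)) * sin ((real (n + 1) / 2 - real j) * \<phi>))" .
    have outer: "1 - cis \<phi> ^ (n + 1) = u * of_real (sin (real (n + 1) * \<phi> / 2))"
      using diff[of 0] by simp
    have first: "cis \<phi> - cis \<phi> ^ n = u * of_real (sin (real (n - 1) * \<phi> / 2))"
      using diff[of 1] n_ge_2 unfolding half by simp
    show ?thesis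
      unfolding summation_by_parts inner outer first by (simp add: ring_distribs mult_ac)
  qed
  finally show ?thesis
    using u by (subst (asm) mult_left_cancel) (auto simp only: of_real_eq_iff)
qed

text \<open>
  The arguments of the solutions of \<open>y\<^bsup>n-1\<^esup> = -1\<close>. There \<open>sin ((n - 1) \<phi> / 2)\<close>, the coefficient of
  \<open>2 \<eta> a\<^sub>1\<close> in the summation by parts, is alternately \<open>1\<close> and \<open>-1\<close>.
\<close>

definition node :: "nat \<Rightarrow> real" where
  "node m = (2 * real m + 1) * pi / real (n - 1)"

lemma node_range:
  assumes "m < n - 1"
  shows "0 < node m" "node m < 2 * pi"
proof -
  have "2 * real m + 1 < 2 * real (n - 1)" using assms by linarith
  hence "(2 * real m + 1) * pi < 2 * real (n - 1) * pi"
    by (intro mult_strict_right_mono) auto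
  thus "0 < node m" "node m < 2 * pi"
    using assms by (auto simp: node_def pos_divide_less_eq mult_ac intro!: divide_pos_pos mult_pos_pos)
qed

lemma node_mono:
  assumes "m \<le> m'"
  shows "node m \<le> node m'"
  using assms unfolding node_def by (intro divide_right_mono mult_right_mono) auto

text \<open>
  At a node the term with \<open>a\<^sub>1\<close> has absolute value \<open>2 a\<^sub>1\<close>. The differences contribute at most their total variation
  \<open>2 (a\<^sub>1 - M)\<close> for the middle value \<open>M\<close>, and the two terms with \<open>E\<close> at most \<open>4 E\<close>. As \<open>M > 2 E\<close>,
  the first term decides the sign.
\<close>

lemma T_alternates:
  assumes "m < n - 1"
  shows "\<eta> * (-1) ^ m * T (node m) > 0"
proof -
  define s :: real where "s = (-1) ^ m"
  define V where "V = (\<Sum>j=2..<n. (a j - a (j - 1)) * sin ((real (n + 1) / 2 - real j) * node m))"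
  define w where "w = sin (real (n + 1) * node m / 2)"
  have s: "s * s = 1" "\<bar>s\<bar> = 1" by (simp_all add: s_def flip: power_mult_distrib)
  have eta: "\<eta> * \<eta> = 1" "\<bar>\<eta>\<bar> = 1" using sign by auto
  have "real (n - 1) * node m / 2 = real m * pi + pi / 2"
    using assms by (simp add: node_def field_simps)
  moreover have "sin (real m * pi + pi / 2) = s"
    by (simp add: sin_add s_def)
  ultimately have sin_s: "sin (real (n - 1) * node m / 2) = s"
    by (simp only:)
  have "\<bar>V\<bar> \<le> (\<Sum>j=2..<n. \<bar>a j - a (j - 1)\<bar>)"
    unfolding V_def
    by (rule order_trans[OF sum_abs]) (auto intro!: sum_mono simp: abs_mult mult_left_le)
  also have "\<dots> = 2 * (a 1 - a (n div 2))"
    by (rule total_variation)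
  finally have V: "\<bar>s * V\<bar> \<le> 2 * (a 1 - a (n div 2))"
    using s by (simp add: abs_mult)
  have "\<bar>\<eta> * s * w\<bar> \<le> 1"
    using s eta by (simp add: abs_mult w_def)
  hence "E * \<bar>\<eta> * s * w\<bar> \<le> E * 1"
    using E_pos by (intro mult_left_mono) auto
  hence w: "\<bar>E * (\<eta> * s * w)\<bar> \<le> E" using E_pos by (simp add: abs_mult)
  have e: "\<bar>E * \<eta>\<bar> = E" using E_pos eta by (simp add: abs_mult)
  have "2 * sin (node m / 2) * (\<eta> * s * T (node m)) = \<eta> * s * (2 * (sin (node m / 2) * T (node m)))"
    by simp
  also have "\<dots> = \<eta> * s * (2 * E * w + 2 * (\<eta> * a 1 - E) * s + \<eta> * V)"
    unfolding T_by_parts sin_s w_def V_def by simp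
  also have "\<dots> = 2 * (E * (\<eta> * s * w)) + 2 * a 1 * (\<eta> * \<eta>) * (s * s) - 2 * (E * \<eta>) * (s * s) + s * V * (\<eta> * \<eta>)"
    by (simp add: algebra_simps)
  also have "\<dots> = 2 * (E * (\<eta> * s * w)) + 2 * a 1 - 2 * (E * \<eta>) + s * V"
    by (simp add: s eta)
  also have "\<dots> > 0"
  proof -
    have "- (2 * (a 1 - a (n div 2))) \<le> s * V" "- E \<le> E * (\<eta> * s * w)" "E * \<eta> \<le> E"
      using V w e by (simp_all only: abs_le_iff minus_le_iff)
    thus ?thesis using middle by (simp add: algebra_simps)
  qed
  finally have "2 * sin (node m / 2) * (\<eta> * s * T (node m)) > 0" .
  moreover have "sin (node m / 2) > 0"
    using node_range[OF assms] by (intro sin_gt_zero) auto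
  ultimately show ?thesis
    unfolding s_def by (simp add: zero_less_mult_iff)
qed

lemma T_zero_between:
  assumes "m < n - 2"
  obtains \<phi> where "node m < \<phi>" "\<phi> < node (Suc m)" "T \<phi> = 0"
proof -
  define g where "g = (\<lambda>\<phi>. \<eta> * (-1) ^ m * T \<phi>)"
  have g: "g (node m) > 0" "g (node (Suc m)) < 0"
    using T_alternates[of m] T_alternates[of "Suc m"] assms by (auto simp: g_def)
  have "continuous_on {node m..node (Suc m)} g"
    unfolding g_def T_def by (intro continuous_intros)
  from IVT2'[OF _ _ _ this, of 0] obtain x
    where x: "node m \<le> x" "x \<le> node (Suc m)" "g x = 0"
    using g node_mono[of m "Suc m"] by auto
  have "x \<noteq> node m" "x \<noteq> node (Suc m)" "T x = 0"
    using g x(3) sign by (auto simp: g_def)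
  with x show ?thesis by (intro that[of x]) auto
qed

lemma circle_zeros:
  obtains Z :: "complex set"
  where "finite Z" "card Z = n - 2" "\<And>z. z \<in> Z \<Longrightarrow> norm z = 1 \<and> F z = 0"
proof -
  have "\<forall>m. \<exists>\<phi>. m < n - 2 \<longrightarrow> node m < \<phi> \<and> \<phi> < node (Suc m) \<and> T \<phi> = 0"
    using T_zero_between by metis
  then obtain \<phi> where \<phi>: "\<And>m. m < n - 2 \<Longrightarrow> node m < \<phi> m \<and> \<phi> m < node (Suc m) \<and> T (\<phi> m) = 0"
    by metis
  have range: "0 < \<phi> m" "\<phi> m < 2 * pi" if "m < n - 2" for m
  proof -
    have "m < n - 1" "Suc m < n - 1" using that by linarith+
    thus "0 < \<phi> m" "\<phi> m < 2 * pi" using \<phi>[OF that] node_range[of m] node_range[of "Suc m"] by auto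
  qed
  have less: "\<phi> i < \<phi> j" if "i < j" "j < n - 2" for i j
    using \<phi>[of i] \<phi>[of j] node_mono[of "Suc i" j] that by auto
  have "inj_on (\<lambda>m. cis (\<phi> m)) {..<n - 2}"
  proof (rule linorder_inj_onI)
    fix i j assume ij: "i < j" "i \<in> {..<n-2}" "j \<in> {..<n - 2}"
    show "cis (\<phi> i) \<noteq> cis (\<phi> j)"
    proof
      assume "cis (\<phi> i) = cis (\<phi> j)"
      hence "sin (\<phi> i) = sin (\<phi> j) \<and> cos (\<phi> i) = cos (\<phi> j)"
        by (simp add: complex_eq_iff)
      then obtain k where k: "k \<in> \<int>" "\<phi> i = \<phi> j + 2 * pi * k"
        unfolding sin_cos_eq_iff by (force simp: Ints_def)
      then obtain p :: int where p: "k = of_int p" by (elim Ints_cases)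
      have "2 * pi * k < 0" "0 < 2 * pi * (k + 1)"
        using k less[of i j] range[of i] range[of j] ij by (auto simp: distrib_left)
      hence "k < 0" "-1 < k"
        by (auto simp: mult_less_0_iff zero_less_mult_iff)
      thus False unfolding p by auto
    qed
  qed auto
  hence "card ((\<lambda>m. cis (\<phi> m)) ` {..<n - 2}) = n - 2"
    by (simp add: card_image)
  thus ?thesis
    by (intro that[of "(\<lambda>m. cis (\<phi> m)) ` {..<n - 2}"]) (auto simp: F_cis \<phi>)
qed

text \<open>
  Multiplying by \<open>(-\<eta>)\<^sup>n\<close> makes the leading coefficient in \<open>s\<close> equal to \<open>E > 0\<close>.
\<close>

lemma F_leading_sign:
  obtains B where "\<And>s::real. s > B \<Longrightarrow> (-\<eta>) ^ n * F (- \<eta> * s) > 0"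
proof -
  define A where "A = (\<Sum>j<n. \<bar>coef j\<bar>)"
  have eta: "\<bar>-\<eta>\<bar> = 1" "(-\<eta>) ^ n * (-\<eta>) ^ n = 1"
    using sign by (auto simp flip: power_mult_distrib)
  have "(-\<eta>) ^ n * F (- \<eta> * s) > 0" if s: "s > max 1 (A / E)" for s :: real
  proof -
    define L where "L = (\<Sum>j<n. coef j * (- \<eta> * s) ^ j)"
    have "F (- \<eta> * s) = L + E * (- \<eta> * s) ^ n"
      by (simp add: F_def L_def coef_def lessThan_Suc_atMost[symmetric])
    also have "(- \<eta> * s) ^ n = (- \<eta>) ^ n * s ^ n"
      by (rule power_mult_distrib)
    finally have "(-\<eta>) ^ n * F (- \<eta> * s) = (-\<eta>) ^ n * L + E * ((-\<eta>) ^ n * (-\<eta>) ^ n) * s ^ n"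
      by (simp only: distrib_left mult_ac)
    hence eq: "(-\<eta>) ^ n * F (- \<eta> * s) = (-\<eta>) ^ n * L + E * s ^ n"
      unfolding eta by simp
    have "\<bar>L\<bar> \<le> (\<Sum>j<n. \<bar>coef j\<bar> * s ^ (n - 1))"
      unfolding L_def
    proof (rule order_trans[OF sum_abs], rule sum_mono)
      fix j assume "j \<in> {..<n}"
      hence "s ^ j \<le> s ^ (n - 1)" using s by (intro power_increasing) auto
      thus "\<bar>coef j * (- \<eta> * s) ^ j\<bar> \<le> \<bar>coef j\<bar> * s ^ (n - 1)"
        using eta s by (auto simp: abs_mult power_abs intro!: mult_left_mono)
    qed
    also have "\<dots> = A * s ^ (n - 1)" by (simp add: A_def sum_distrib_right)
    also have "\<dots> < (E * s) * s ^ (n - 1)"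
      using s E_pos by (intro mult_strict_right_mono) (auto simp: field_simps)
    also have "\<dots> = E * s ^ n"
      using n_ge_2 by (cases n) auto
    finally have "\<bar>(-\<eta>) ^ n * L\<bar> < E * s ^ n"
      using eta by (simp add: abs_mult power_abs)
    thus ?thesis unfolding eq by linarith
  qed
  thus ?thesis by (rule that)
qed

lemma F_one_negative:
  assumes "\<eta> = -1"
  shows "F (1::real) < 0"
proof -
  have "a 1 \<le> (\<Sum>j=1..<n. a j)"
    using n_ge_2 ge_middle middle E_pos by (intro member_le_sum) force+
  moreover have "a 1 > 2 * E"
    using ge_middle[of 1] middle n_ge_2 by auto
  ultimately show ?thesis
    unfolding F_split using assms by simp
qed

text \<open>
  The same comparison at \<open>y = -2\<close>: with \<open>W = \<bar>y - y\<^sup>n\<bar>\<close>, summation by parts leaves at most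
  \<open>E (1 + 2\<^bsup>n+1\<^esup>) - (M - E) W\<close> for even \<open>n\<close> (and \<open>-1 + 2\<^bsup>n+1\<^esup>\<close> in the bracket for odd \<open>n\<close>). Because of
  \<open>M \<ge> 4 E\<close> this is negative. The point \<open>-1\<close> would not do, since \<open>F\<close> vanishes there if \<open>n\<close> is odd.
\<close>

lemma F_minus_two_sign:
  assumes "\<eta> = 1" and "4 * E \<le> a (n div 2)"
  shows "(-1) ^ n * F (- 2 :: real) < 0"
proof -
  define p :: real where "p = (-1) ^ n"
  define W where "W = 2 ^ n + 2 * p"
  define V where "V = (\<Sum>j=2..<n. (a j - a (j - 1)) * ((- 2) ^ j - (- 2) ^ (n + 1 - j)))"
  have p: "p = 1 \<or> p = -1" by (simp add: p_def minus_one_power_iff)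
  have pow: "(-2 :: real) ^ n = p * 2 ^ n" by (simp add: p_def power_minus[of 2])
  have big: "2 ^ n + 5 * p > 0"
  proof (cases "n = 2")
    case False
    hence "(2::real) ^ 3 \<le> 2 ^ n" using n_ge_2 by (intro power_increasing) auto
    thus ?thesis using p by auto
  qed (simp add: p_def)
  have W: "W \<ge> 0" using big p unfolding W_def by auto
  have dominated: "\<bar>(- 2) ^ j - (- 2) ^ (n + 1 - j)\<bar> \<le> W" if j: "j \<in> {2..<n}" for j
  proof -
    define u v :: real where "u = 2 ^ j" and "v = 2 ^ (n + 1 - j)"
    have "1 \<le> j" "1 \<le> n + 1 - j" using j by auto
    hence "(2::real) ^ 1 \<le> u" "(2::real) ^ 1 \<le> v"
      unfolding u_def v_def by (intro power_increasing; simp)+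
    hence uv: "u \<ge> 2" "v \<ge> 2" by auto
    \<comment> \<open>With \<open>u v = 2\<^bsup>n+1\<^esup>\<close> fixed, \<open>\<bar>u + p v\<bar>\<close> is largest when one factor takes its minimal value \<open>2\<close>.\<close>
    have "u * v = 2 ^ (n + 1)" unfolding u_def v_def using j by (simp flip: power_add)
    hence prod: "u * v = 2 * 2 ^ n" by simp
    have "(-1 :: real) ^ (n + 1 - j) = (-1) ^ (n + 1 + j)"
      using j by (simp add: minus_one_power_iff)
    hence "(-1 :: real) ^ (n + 1 - j) = - p * (-1) ^ j"
      by (simp add: p_def power_add)
    hence "(- 2) ^ j - (- 2) ^ (n + 1 - j) = (-1) ^ j * (u + p * v)"
      unfolding u_def v_def by (subst (1 2) power_minus) (simp add: algebra_simps)
    hence "\<bar>(- 2) ^ j - (- 2) ^ (n + 1 - j)\<bar> = \<bar>u + p * v\<bar>"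
      by (simp add: abs_mult)
    also have "\<dots> \<le> W"
    proof -
      have "0 \<le> (u - 2) * (v - 2)" "0 \<le> (u + 2) * (v - 2)" "0 \<le> (u - 2) * (v + 2)"
        using uv by auto
      thus ?thesis
        using p prod uv by (auto simp: W_def algebra_simps abs_le_iff)
    qed
    finally show ?thesis .
  qed
  have "\<bar>V\<bar> \<le> (\<Sum>j=2..<n. \<bar>a j - a (j - 1)\<bar> * W)"
    unfolding V_def
    by (rule order_trans[OF sum_abs], rule sum_mono, unfold abs_mult)
       (intro mult_left_mono dominated; simp)
  also have "\<dots> = 2 * (a 1 - a (n div 2)) * W"
    by (simp only: sum_distrib_right[symmetric] total_variation)
  finally have "\<bar>p * V\<bar> \<le> 2 * (a 1 - a (n div 2)) * W"
    using p by auto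
  hence V: "p * V \<le> 2 * a 1 * W - 2 * (a (n div 2) * W)"
    by (simp add: algebra_simps)
  have mid: "4 * E * W \<le> a (n div 2) * W"
    using assms(2) W by (intro mult_right_mono)
  have "6 * (p * F (-2)) = p * (2 * ((1 - (-2)) * F (-2 :: real)))" by simp
  also have "\<dots> = p * (2 * E * (1 - (-2) ^ (n + 1)) + 2 * (a 1 - E) * (-2 - (-2) ^ n) + V)"
    by (subst summation_by_parts) (simp add: assms(1) V_def)
  also have "\<dots> = 2 * E * (p + 2 * 2 ^ n) - 2 * (a 1 - E) * W + p * V"
    using p by (auto simp: pow W_def algebra_simps)
  also have "\<dots> \<le> 2 * E * (p + 2 * 2 ^ n) + 2 * E * W - 8 * E * W"
    using V mid by (simp add: algebra_simps)
  also have "\<dots> = - (2 * E * (2 ^ n + 5 * p))"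
    by (simp add: W_def algebra_simps)
  also have "\<dots> < 0" using E_pos big by simp
  finally show ?thesis by (simp add: p_def)
qed

lemma real_zero:
  assumes "\<eta> = 1 \<Longrightarrow> 4 * E \<le> a (n div 2)"
  obtains r :: real where "r > 1" "F (- \<eta> * r) = 0"
proof -
  define g where "g = (\<lambda>s::real. (-\<eta>) ^ n * F (- \<eta> * s))"
  obtain s0 :: real where s0: "s0 \<ge> 1" "g s0 < 0"
  proof (cases "\<eta> = 1")
    case True
    thus ?thesis using F_minus_two_sign assms by (intro that[of 2]) (auto simp: g_def)
  next
    case False
    hence "\<eta> = -1" using sign by simp
    thus ?thesis using F_one_negative by (intro that[of 1]) (auto simp: g_def)
  qed
  obtain B where B: "\<And>s. s > B \<Longrightarrow> g s > 0"
    using F_leading_sign unfolding g_def by blast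
  define s1 where "s1 = max s0 (B + 1)"
  have s1: "s0 \<le> s1" "g s1 > 0" by (auto simp: s1_def intro!: B)
  have "continuous_on {s0..s1} g"
    unfolding g_def F_def by (intro continuous_intros)
  from IVT'[OF _ _ _ this, of 0] obtain r where r: "s0 \<le> r" "g r = 0"
    using s0 s1 by auto
  moreover have "r \<noteq> s0" using r s0 by auto
  moreover have "F (- \<eta> * r) = 0" using r(2) sign by (auto simp: g_def)
  ultimately show ?thesis using s0 by (intro that[of r]) auto
qed

theorem zeros:
  assumes "\<eta> = 1 \<Longrightarrow> 4 * E \<le> a (n div 2)"
  obtains r :: real and Z :: "complex set"
  where "r > 1" "F (complex_of_real (- \<eta> * r)) = 0" "F (complex_of_real (- \<eta> * (1 / r))) = 0"
    "finite Z" "card Z = n - 2" "\<And>z. z \<in> Z \<Longrightarrow> norm z = 1 \<and> F z = 0"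
proof -
  obtain r :: real where r: "r > 1" "F (- \<eta> * r) = 0"
    using real_zero assms by blast
  obtain Z :: "complex set"
    where Z: "finite Z" "card Z = n - 2" "\<And>z. z \<in> Z \<Longrightarrow> norm z = 1 \<and> F z = 0"
    using circle_zeros by blast
  have nz: "- \<eta> * r \<noteq> 0" and inv: "inverse (- \<eta> * r) = - \<eta> * (1 / r)"
    using r(1) sign by (auto simp: field_simps)
  have "F (- \<eta> * (1 / r)) = 0"
    using F_inverse[OF nz] nz unfolding inv r(2) by auto
  with r Z show ?thesis
    by (intro that[of r Z]) (simp_all only: F_of_real of_real_0)
qed

end

section \<open>Locating the zeros of R\<close>

lemma simple_zeros_if_enough_zeros:
  fixes p :: "'a :: idom poly"
  assumes "p \<noteq> 0" and "finite Z" and "\<And>z. z \<in> Z \<Longrightarrow> poly p z = 0" and "degree p \<le> card Z"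
  shows "{z. poly p z = 0} = Z" and "\<And>z. poly p z = 0 \<Longrightarrow> order z p = 1"
proof -
  let ?A = "{z. poly p z = 0}"
  have fin: "finite ?A" by (rule poly_roots_finite[OF assms(1)])
  have sub: "Z \<subseteq> ?A" using assms(3) by auto
  have ge: "order z p \<ge> 1" if "z \<in> ?A" for z
    using that assms(1) order_root[of p z] by (simp add: Suc_le_eq)
  have "card ?A \<le> (\<Sum>z\<in>?A. order z p)"
    using sum_mono[of ?A "\<lambda>_. 1" "\<lambda>z. order z p"] ge by simp
  moreover have "(\<Sum>z\<in>?A. order z p) \<le> degree p"
    using sum_order_le_degree[OF assms(1)] by simp
  moreover have "card Z \<le> card ?A"
    by (rule card_mono[OF fin sub])
  ultimately have eq: "card Z = card ?A" "(\<Sum>z\<in>?A. 1) = (\<Sum>z\<in>?A. order z p)"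
    using assms(4) by auto
  show "?A = Z"
    using card_subset_eq[OF fin sub eq(1)] by simp
  show "order z p = 1" if "poly p z = 0" for z
  proof (rule ccontr)
    assume "order z p \<noteq> 1"
    hence "1 < order z p" using ge[of z] that by simp
    hence "(\<Sum>z\<in>?A. 1) < (\<Sum>z\<in>?A. order z p)"
      using fin that ge by (intro sum_strict_mono_ex1) auto
    thus False using eq(2) by simp
  qed
qed

definition zeta_coef :: "nat \<Rightarrow> nat \<Rightarrow> nat \<Rightarrow> real" where
  "zeta_coef n l j = (2 * even_zeta j * even_zeta (n - j)) ^ l"

text \<open>
  Since \<open>\<zeta>(2j) > 1\<close> and \<open>\<zeta>(2n - 2j) \<ge> \<zeta>(2n)\<close>. For \<open>E = \<zeta>(2n)\<^sup>l\<close> this is the bound \<open>2 E\<close> in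
  general and \<open>4 E\<close> for even \<open>l\<close>, where \<open>l \<ge> 2\<close>.
\<close>

lemma zeta_coef_lower_bound:
  assumes "1 \<le> j" "j < n" "l \<ge> 1"
  shows "2 ^ l * even_zeta n ^ l < zeta_coef n l j"
proof -
  have "even_zeta n \<le> even_zeta (n - j)" "even_zeta n > 1" "even_zeta j > 1"
    using assms by (auto intro: even_zeta_antimono even_zeta_gt_1)
  hence "1 * even_zeta n < even_zeta j * even_zeta (n - j)"
    by (intro mult_less_le_imp_less) auto
  hence "(2 * even_zeta n) ^ l < (2 * even_zeta j * even_zeta (n - j)) ^ l"
    using assms(3) \<open>even_zeta n > 1\<close> by (intro power_strict_mono) auto
  thus ?thesis by (simp add: zeta_coef_def power_mult_distrib)
qed

lemma valley_zeta:
  assumes "n \<ge> 2" "l \<ge> 1"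
  shows "valley_polynomial n (even_zeta n ^ l) ((-1) ^ l) (zeta_coef n l)"
proof
  show "n \<ge> 2" by fact
  show "even_zeta n ^ l > 0" using even_zeta_gt_1[of n] assms by simp
  show "(-1 :: real) ^ l = 1 \<or> (-1 :: real) ^ l = -1" by (simp add: minus_one_power_iff)
  show "zeta_coef n l (n - j) = zeta_coef n l j" if "1 \<le> j" "j < n" for j
    using that by (simp add: zeta_coef_def mult_ac)
  show "zeta_coef n l (Suc j) \<le> zeta_coef n l j" if j: "1 \<le> j" "2 * Suc j \<le> n" for j
  proof -
    have "1 \<le> n - Suc j" using j by simp
    hence "even_zeta (Suc j) > 1" "even_zeta (n - Suc j) > 1"
      by (auto intro: even_zeta_gt_1)
    thus ?thesis
      unfolding zeta_coef_def mult.assoc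
      using even_zeta_product_decreasing[OF j] by (intro power_mono) auto
  qed
  have "2 ^ 1 * even_zeta n ^ l \<le> 2 ^ l * even_zeta n ^ l"
    using assms even_zeta_gt_1[of n] by (intro mult_right_mono power_increasing) auto
  also have "\<dots> < zeta_coef n l (n div 2)"
    using assms by (intro zeta_coef_lower_bound) auto
  finally show "2 * even_zeta n ^ l < zeta_coef n l (n div 2)" by simp
qed

text \<open>
  The factor \<open>(-1)\<^bsup>j+1\<^esup>\<close> in Euler's formula makes the sign of every product with \<open>0 < j < n\<close> equal to \<open>(-1)\<^sup>n\<close>,
  and the sign of the two outermost ones opposite, as \<open>B\<^sub>0 = 1\<close> breaks the pattern. After the \<open>l\<close>-th power
  this leaves the relative sign \<open>\<eta> = (-1)\<^sup>l\<close>, and \<open>(-1)\<^bsup>(l+1)j\<^esup> = (-\<eta>)\<^sup>j\<close> is absorbed into the variable.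
\<close>

lemma poly_R_poly:
  assumes "k \<ge> 1" "l \<ge> 1"
  shows "poly (R_poly k l) x =
           of_real (((-1) ^ k * 2 / (2 * pi) ^ (2 * (k + 1))) ^ l) *
           valley_polynomial.F (k + 1) (even_zeta (k + 1) ^ l) ((-1) ^ l) (zeta_coef (k + 1) l)
             (of_real (- ((-1) ^ l)) * x)"
proof -
  define n where "n = k + 1"
  define b where "b j = bernoulli (2 * j) / fact (2 * j)" for j
  interpret valley_polynomial n "even_zeta n ^ l" "(-1) ^ l" "zeta_coef n l"
    using assms by (intro valley_zeta) (auto simp: n_def)
  define D where "D = (-1) ^ k * 2 / (2 * pi) ^ (2 * n)"
  have b0: "b 0 = 1"
    using bernoulli_sums[of 0] powser_sums_zero_iff[of "\<lambda>j. complex_of_real (bernoulli j) / fact j" 1]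
    by (simp add: b_def)
  have b: "b j = (-1) ^ (j + 1) * 2 * even_zeta j / (2 * pi) ^ (2 * j)" if "j \<ge> 1" for j
    unfolding b_def by (rule bernoulli_eq_even_zeta[OF that])
  have bn: "b n = D * even_zeta n"
    by (subst b) (auto simp: n_def D_def)
  have bb: "b j * b (n - j) = D * - (2 * even_zeta j * even_zeta (n - j))" if j: "1 \<le> j" "j < n" for j
  proof -
    have "(2 * pi) ^ (2 * j) * (2 * pi) ^ (2 * (n - j)) = (2 * pi) ^ (2 * n)"
      using j by (simp flip: power_add add: algebra_simps)
    moreover have "(-1::real) ^ (j + 1) * (-1) ^ (n - j + 1) = - ((-1) ^ k)"
      using j by (simp flip: power_add add: n_def)
    ultimately show ?thesis
      using j by (simp add: b D_def field_simps)
  qed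
  have coef: "(b j * b (n - j)) ^ l = D ^ l * coef j" if "j \<le> n" for j
  proof (cases "j = 0 \<or> j = n")
    case True
    thus ?thesis by (auto simp: coef_def b0 bn power_mult_distrib)
  next
    case False
    hence "b j * b (n - j) = D * ((-1) * (2 * even_zeta j * even_zeta (n - j)))"
      using that bb[of j] by simp
    hence "(b j * b (n - j)) ^ l = D ^ l * ((-1) ^ l * zeta_coef n l j)"
      by (simp only: zeta_coef_def power_mult_distrib)
    thus ?thesis
      using False by (simp add: coef_def)
  qed
  have eps: "(-1::real) ^ ((l + 1) * j) = (- ((-1) ^ l)) ^ j" for j
    by (subst power_mult) simp
  have "poly (R_poly k l) x = (\<Sum>j\<le>n. of_real ((-1) ^ ((l + 1) * j) * (b j * b (n - j)) ^ l) * x ^ j)"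
    unfolding R_poly_def poly_sum poly_monom atLeast0AtMost n_def b_def
    by (intro sum.cong refl) (simp add: diff_mult_distrib2)
  also have "\<dots> = (\<Sum>j\<le>n. of_real (D ^ l) * (of_real (coef j) * (of_real (- ((-1) ^ l)) * x) ^ j))"
  proof (intro sum.cong refl)
    fix j assume "j \<in> {..n}"
    hence real: "(-1) ^ ((l + 1) * j) * (b j * b (n - j)) ^ l = D ^ l * (coef j * (- ((-1) ^ l)) ^ j)"
      unfolding eps by (simp only: coef atMost_iff mult_ac)
    show "of_real ((-1) ^ ((l + 1) * j) * (b j * b (n - j)) ^ l) * x ^ j =
            of_real (D ^ l) * (of_real (coef j) * (of_real (- ((-1) ^ l)) * x) ^ j)"
      unfolding real by (simp only: power_mult_distrib of_real_mult of_real_power mult_ac)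
  qed
  also have "\<dots> = of_real (D ^ l) * F (of_real (- ((-1) ^ l)) * x)"
    by (simp add: F_def sum_distrib_left)
  finally show ?thesis by (simp add: D_def n_def)
qed

lemma degree_R_poly: "degree (R_poly k l) \<le> k + 1"
  unfolding R_poly_def by (intro degree_sum_le) (auto intro: order_trans[OF degree_monom_le])

theorem theorem1p1:
  fixes k l :: nat
  assumes "k \<ge> 1" and "l \<ge> 1"
  shows "(\<forall>z. poly (R_poly k l) z = 0 \<longrightarrow> z \<notin> \<real> \<longrightarrow> norm z = 1) \<and>
         (\<exists>\<alpha>::real. \<alpha> > 1 \<and>
            poly (R_poly k l) (complex_of_real \<alpha>) = 0 \<and>
            poly (R_poly k l) (complex_of_real (1 / \<alpha>)) = 0 \<and>
            (\<forall>z. poly (R_poly k l) z = 0 \<longrightarrow>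
                 z \<noteq> complex_of_real \<alpha> \<longrightarrow> z \<noteq> complex_of_real (1 / \<alpha>) \<longrightarrow>
                 norm z = 1)) \<and>
         (\<forall>z. poly (R_poly k l) z = 0 \<longrightarrow> order z (R_poly k l) = 1)"
proof -
  define n where "n = k + 1"
  define \<eta> :: real where "\<eta> = (-1) ^ l"
  define D where "D = ((-1) ^ k * 2 / (2 * pi) ^ (2 * n)) ^ l"
  interpret valley_polynomial n "even_zeta n ^ l" \<eta> "zeta_coef n l"
    unfolding \<eta>_def using assms by (intro valley_zeta) (auto simp: n_def)
  have R: "poly (R_poly k l) x = of_real D * F (of_real (- \<eta>) * x)" for x
    using poly_R_poly[OF assms, of x] by (simp only: D_def \<eta>_def n_def)
  have eta: "\<eta> * \<eta> = 1" "\<bar>\<eta>\<bar> = 1" using sign by auto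
  have "4 * even_zeta n ^ l \<le> zeta_coef n l (n div 2)" if "\<eta> = 1"
  proof -
    have "l \<ge> 2" using that assms(2) by (cases "l = 1") (auto simp: \<eta>_def)
    hence "2 ^ 2 * even_zeta n ^ l \<le> 2 ^ l * even_zeta n ^ l"
      using n_ge_2 even_zeta_gt_1[of n] by (intro mult_right_mono power_increasing) auto
    also have "\<dots> \<le> zeta_coef n l (n div 2)"
      using n_ge_2 assms by (intro less_imp_le[OF zeta_coef_lower_bound]) auto
    finally show ?thesis by simp
  qed
  from zeros[OF this] obtain r :: real and Z :: "complex set"
    where r: "r > 1" "F (complex_of_real (- \<eta> * r)) = 0" "F (complex_of_real (- \<eta> * (1 / r))) = 0"
      and Z: "finite Z" "card Z = n - 2" "\<And>z. z \<in> Z \<Longrightarrow> norm z = 1 \<and> F z = 0"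
    by blast
  define C where "C = (\<lambda>z. of_real (- \<eta>) * z) ` Z"
  have C: "finite C" "card C = n - 2"
  proof -
    have "inj_on (\<lambda>z. of_real (- \<eta>) * z) Z"
      using eta by (auto simp: inj_on_def)
    thus "finite C" "card C = n - 2"
      unfolding C_def using Z(1,2) by (simp_all only: card_image finite_imageI)
  qed
  have C_zero: "norm z = 1 \<and> poly (R_poly k l) z = 0" if in_C: "z \<in> C" for z
  proof -
    obtain y where y: "y \<in> Z" "z = of_real (- \<eta>) * y"
      using in_C unfolding C_def by blast
    have "of_real (- \<eta>) * z = of_real (\<eta> * \<eta>) * y" by (simp add: y(2))
    hence "of_real (- \<eta>) * z = y" by (simp only: eta of_real_1 mult_1)
    hence "poly (R_poly k l) z = 0" using Z(3)[OF y(1)] unfolding R by simp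
    thus ?thesis using Z(3)[OF y(1)] eta by (simp add: y(2) norm_mult)
  qed
  define A where "A = insert (complex_of_real r) (insert (complex_of_real (1 / r)) C)"
  have "1 / r < r"
    using r(1) by (intro less_trans[of "1 / r" 1 r]) auto
  hence "complex_of_real r \<noteq> complex_of_real (1 / r)"
    by (simp only: of_real_eq_iff)
  moreover have "complex_of_real r \<notin> C" "complex_of_real (1 / r) \<notin> C"
    using C_zero r(1) by (force simp: field_simps norm_divide)+
  ultimately have card: "card A = n"
    using C n_ge_2 by (simp add: A_def)
  have A_zero: "poly (R_poly k l) z = 0" if "z \<in> A" for z
    using that C_zero r(2,3) unfolding A_def R by (auto simp: R)
  have nonzero: "R_poly k l \<noteq> 0"
  proof
    assume "R_poly k l = 0"
    hence "of_real D * F (0 :: complex) = 0"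
      using R[of 0] by simp
    moreover have "F (0 :: complex) = of_real (even_zeta n ^ l)"
      unfolding F_split using n_ge_2 by (subst sum.neutral) auto
    moreover have "even_zeta n \<noteq> 0"
      using even_zeta_gt_1[of n] n_ge_2 by simp
    ultimately show False
      by (simp add: D_def)
  qed
  note simple = simple_zeros_if_enough_zeros[OF nonzero, of A]
  have all: "{z. poly (R_poly k l) z = 0} = A"
    using C(1) A_zero card degree_R_poly[of k l] by (intro simple) (auto simp: A_def n_def)
  have "order z (R_poly k l) = 1" if "poly (R_poly k l) z = 0" for z
    using C(1) A_zero card degree_R_poly[of k l] that by (intro simple) (auto simp: A_def n_def)
  moreover have "norm z = 1" if "poly (R_poly k l) z = 0" "z \<noteq> of_real r" "z \<noteq> of_real (1 / r)" for z
    using that all C_zero by (auto simp: A_def)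
  moreover have "poly (R_poly k l) (of_real r) = 0" "poly (R_poly k l) (of_real (1 / r)) = 0"
    using A_zero by (auto simp: A_def)
  ultimately show ?thesis
    using r(1) by (metis Reals_of_real)
qed

end
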